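(* Let $F$ be an AM-space and let $K_F$ be the set of vector lattice homomorphisms $F\to\mathbb{R}$ of norm at most $1$, endowed with the weak* topology. Then $F$ is semicontinuous if and only if $F$ is a regular sublattice of $C(K_F)$, where $F$ is embedded into $C(K_F)$ by evaluation, $f(x):=x(f)$ for $f\in F$, $x\in K_F$.
   Context: An AM-space is a norm complete normed lattice (real vector lattice with a solid norm) such that $\|e\vee f\|=\max(\|e\|,\|f\|)$ for all $e,f\ge 0$. $K_F$ is a compact Hausdorff space, $[0,1]K_F\subset K_F$, and evaluation identifies $F$ isometrically with the closed sublattice $C_{\mathrm{ph}}(K_F)$ of $C(K_F)$ consisting of the continuous functions $f$ on $K_F$ with $f(tx)=tf(x)$ for $x\in K_F$, $0\le t\le 1$. $F$ is semicontinuous if whenever $P\subset F_+$ is an upward directed set of elements of norm at most $1$ with supremum $f\in F$, then $\|f\|\le1$. A sublattice $E$ of a vector lattice $G$ is regular if whenever $P\subset E$ has infimum $0$ in $E$, it has infimum $0$ in $G$. *)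

theory Defs
  imports "HOL-Analysis.Analysis" "HOL-Library.Lub_Glb"
begin

class normed_lattice = real_normed_vector + ordered_real_vector + lattice +
  assumes norm_solid: "sup x (- x) \<le> sup y (- y) \<Longrightarrow> norm x \<le> norm y"

class am_space = normed_lattice + banach +
  assumes norm_sup_eq_max: "0 \<le> x \<Longrightarrow> 0 \<le> y \<Longrightarrow> norm (sup x y) = max (norm x) (norm y)"

definition upward_directed :: "'a::order set \<Rightarrow> bool" where
  "upward_directed P \<longleftrightarrow> P \<noteq> {} \<and> (\<forall>p\<in>P. \<forall>q\<in>P. \<exists>r\<in>P. p \<le> r \<and> q \<le> r)"

definition semicontinuous :: "'a::normed_lattice itself \<Rightarrow> bool" where
  "semicontinuous _ \<longleftrightarrow>
    (\<forall>(P :: 'a set) f.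
      (\<forall>p\<in>P. 0 \<le> p \<and> norm p \<le> 1) \<and> upward_directed P \<and> isLub UNIV P f \<longrightarrow> norm f \<le> 1)"

definition vector_lattice_hom ::
  "('a::{ordered_real_vector,lattice} \<Rightarrow> 'b::{ordered_real_vector,lattice}) \<Rightarrow> bool" where
  "vector_lattice_hom x \<longleftrightarrow>
    linear x \<and> (\<forall>f g. x (sup f g) = sup (x f) (x g) \<and> x (inf f g) = inf (x f) (x g))"

text \<open>For real-valued operators the strong operator topology (pointwise convergence on \<open>F\<close>) is the
  weak* topology of the dual space of \<open>F\<close>.\<close>

definition K_top :: "('a::normed_lattice \<Rightarrow>\<^sub>L real) topology" where
  "K_top = subtopology strong_operator_topology
     {x. vector_lattice_hom (blinfun_apply x) \<and> norm x \<le> 1}"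

text \<open>A function on the space \<open>X\<close> is represented by its extension by \<open>0\<close> to the whole type, so that
  equality and the order, lattice and vector space operations of \<open>C(X)\<close> are the pointwise ones.\<close>

definition C_of :: "'k topology \<Rightarrow> ('k \<Rightarrow> real) set" where
  "C_of X = {g. continuous_map X euclideanreal g \<and> (\<forall>x. x \<notin> topspace X \<longrightarrow> g x = 0)}"

definition evaluation :: "'a::normed_lattice \<Rightarrow> ('a \<Rightarrow>\<^sub>L real) \<Rightarrow> real" where
  "evaluation f = (\<lambda>x. if x \<in> topspace K_top then blinfun_apply x f else 0)"

definition vector_sublattice :: "('k \<Rightarrow> real) set \<Rightarrow> ('k \<Rightarrow> real) set \<Rightarrow> bool" where
  "vector_sublattice E G \<longleftrightarrow> E \<subseteq> G \<and> (\<lambda>_. 0) \<in> E \<and>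
    (\<forall>f\<in>E. \<forall>g\<in>E. (\<lambda>x. f x + g x) \<in> E) \<and>
    (\<forall>c. \<forall>f\<in>E. (\<lambda>x. c * f x) \<in> E) \<and>
    (\<forall>f\<in>E. \<forall>g\<in>E. sup f g \<in> E \<and> inf f g \<in> E)"

text \<open>The infimum is only considered for nonempty \<open>P\<close>. This matters solely for \<open>E = {0}\<close>: there the
  empty set has infimum \<open>0\<close> in \<open>E\<close>, but it has no infimum in any nonzero \<open>G\<close>.\<close>

definition regular_sublattice :: "('k \<Rightarrow> real) set \<Rightarrow> ('k \<Rightarrow> real) set \<Rightarrow> bool" where
  "regular_sublattice E G \<longleftrightarrow> vector_sublattice E G \<and>
    (\<forall>P. P \<subseteq> E \<and> P \<noteq> {} \<and> isGlb E P (\<lambda>_. 0) \<longrightarrow> isGlb G P (\<lambda>_. 0))"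

end

theory Submission
  imports Defs "HOL-Library.Lattice_Algebras"
begin

text \<open>
  If \<open>F\<close> is regular in \<open>C(K)\<close> and \<open>f = sup P\<close> with \<open>P\<close> in the positive part of the unit ball, then
  \<open>f - P\<close> has infimum \<open>0\<close> in \<open>C(K)\<close>, while \<open>(f - 1)\<^sup>+\<close> is a lower bound of it there; hence \<open>f \<le> 1\<close> on
  \<open>K\<close>.

  Conversely let \<open>inf P = 0\<close> in \<open>F\<close> and let \<open>g \<in> C(K)\<close> be a lower bound of \<open>P\<close> with \<open>g(x) > 0\<close>. The set
  \<open>Q\<close> of all positive \<open>q \<in> F\<close> with \<open>g \<le> q\<close> is downward directed with infimum \<open>0\<close>. Choose a positive
  \<open>u\<close> in the unit ball of \<open>F\<close> and \<open>b < \<parallel>u\<parallel>\<close> such that \<open>u(y) > b\<close> forces \<open>\<parallel>x\<parallel> y\<close> to be so close to \<open>x\<close>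
  that \<open>g(\<parallel>x\<parallel> y) > g(x) / 2\<close>, and so \<open>q(y) > g(x) / 2\<close> for all \<open>q \<in> Q\<close>. For \<open>r = 2 / g(x)\<close> the
  functions \<open>(u - r q)\<^sup>+\<close> increase to \<open>u\<close> and have norm at most \<open>b\<close>, contradicting semicontinuity.

  That the evaluation is isometric comes from Zorn's lemma: for \<open>f \<ge> 0\<close> of norm \<open>1\<close>, an ideal maximal
  among those at distance \<open>1\<close> from \<open>f\<close> is prime by the AM-property, and \<open>F\<close> modulo this ideal is spanned
  by \<open>f\<close>.
\<close>

section \<open>Normed lattices\<close>

instance normed_lattice \<subseteq> lattice_ab_group_add ..

abbreviation labs :: "'a::lattice_ab_group_add \<Rightarrow> 'a" where
  "labs x \<equiv> sup x (- x)"

lemma labs_nonneg: "0 \<le> labs (x::'a::lattice_ab_group_add)"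
proof -
  have "x + - x \<le> labs x + labs x"
    by (rule add_mono) auto
  then show ?thesis by simp
qed

lemma le_labs_diff: "x \<le> y + labs (x - y)"
  using sup_ge1[of "x - y" "- (x - y)"] by (simp only: diff_le_eq add.commute)

lemma le_labs_diff': "y \<le> x + labs (x - y)"
  using sup_ge2[of "- (x - y)" "x - y"] by (simp only: minus_diff_eq diff_le_eq add.commute)

lemma norm_mono_nonneg:
  fixes x y :: "'a::normed_lattice"
  assumes "0 \<le> x" "x \<le> y"
  shows "norm x \<le> norm y"
proof (rule norm_solid)
  have "labs x = x"
    using assms by (intro sup_absorb1) (meson neg_le_0_iff_le order_trans)
  then show "labs x \<le> labs y"
    using assms by (simp add: le_supI1)
qed

lemma norm_labs [simp]: "norm (labs x) = norm (x::'a::normed_lattice)"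
proof -
  have "- labs x \<le> labs x"
    using labs_nonneg[of x] by (meson neg_le_0_iff_le order_trans)
  then have "labs (labs x) = labs x"
    by (rule sup_absorb1)
  then show ?thesis
    by (intro antisym norm_solid) auto
qed

text \<open>For positive \<open>r\<close> scaling is an order automorphism with inverse scaling by
  \<open>1 / r\<close>, so it preserves suprema.\<close>

lemma scaleR_sup:
  fixes x y :: "'a::normed_lattice"
  assumes "0 \<le> r"
  shows "r *\<^sub>R sup x y = sup (r *\<^sub>R x) (r *\<^sub>R y)"
proof (cases "r = 0")
  case False
  with assms have r: "0 < r" by simp
  show ?thesis
  proof (rule antisym)
    have "sup x y \<le> (1 / r) *\<^sub>R sup (r *\<^sub>R x) (r *\<^sub>R y)"
      using scaleR_left_mono[of "r *\<^sub>R x" "sup (r *\<^sub>R x) (r *\<^sub>R y)" "1 / r"]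
        scaleR_left_mono[of "r *\<^sub>R y" "sup (r *\<^sub>R x) (r *\<^sub>R y)" "1 / r"] r
      by (intro sup_least) simp_all
    from scaleR_left_mono[OF this assms] r
    show "r *\<^sub>R sup x y \<le> sup (r *\<^sub>R x) (r *\<^sub>R y)"
      by simp
    show "sup (r *\<^sub>R x) (r *\<^sub>R y) \<le> r *\<^sub>R sup x y"
      using assms by (intro sup_least scaleR_left_mono) auto
  qed
qed simp

lemma labs_scaleR: "labs (r *\<^sub>R x) = \<bar>r\<bar> *\<^sub>R labs (x::'a::normed_lattice)"
proof (cases "0 \<le> r")
  case True
  then show ?thesis by (simp add: scaleR_sup)
next
  case False
  then have "0 \<le> - r" by simp
  from scaleR_sup[OF this, of x "- x"] show ?thesis
    using False by (simp add: sup_commute)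
qed

lemma le_pprt: "x \<le> pprt (x::'a::lattice_ab_group_add)"
  by (simp add: pprt_def)

lemma pprt_le: "x \<le> y \<Longrightarrow> 0 \<le> y \<Longrightarrow> pprt x \<le> (y::'a::lattice_ab_group_add)"
  by (simp add: pprt_def)

text \<open>Since \<open>pprt (- x) = pprt x - x\<close>, the term \<open>pprt x\<close> can be
  translated out of the infimum. This disjointness is what \<open>prime\<close> is applied to in
  \<open>exists_coordinate\<close>.\<close>

lemma inf_pprt_uminus: "inf (pprt x) (pprt (- x)) = (0::'a::lattice_ab_group_add)"
proof -
  have "pprt (- x) = pprt x - x"
    by (metis add.commute add_diff_cancel_left' diff_conv_add_uminus pprt_neg prts)
  then have "inf (pprt x) (pprt (- x)) = pprt x + inf 0 (- x)"
    by (simp add: add_inf_distrib_left)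
  also have "inf 0 (- x) = - pprt x"
    by (simp add: pprt_def inf_eq_neg_sup[of 0 "- x"] sup_commute[of 0])
  finally show ?thesis by simp
qed

section \<open>Kakutani's theorem: enough lattice homomorphisms\<close>

text \<open>The positive part of an order ideal whose distance to \<open>f\<close> is at least \<open>1\<close>.\<close>

locale distant_cone =
  fixes f :: "'a::normed_lattice" and J :: "'a set"
  assumes zero_mem: "0 \<in> J"
    and mem_nonneg: "a \<in> J \<Longrightarrow> 0 \<le> a"
    and add_mem: "a \<in> J \<Longrightarrow> b \<in> J \<Longrightarrow> a + b \<in> J"
    and scaleR_mem: "a \<in> J \<Longrightarrow> 0 \<le> r \<Longrightarrow> r *\<^sub>R a \<in> J"
    and down_mem: "0 \<le> a \<Longrightarrow> a \<le> b \<Longrightarrow> b \<in> J \<Longrightarrow> a \<in> J"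
    and dist_ge: "j \<in> J \<Longrightarrow> 1 \<le> norm (pprt (f - j))"

text \<open>Zorn's lemma, started from \<open>{0}\<close>, which qualifies because \<open>f\<close>
  has norm 1. For the union of a chain, only closure under addition takes two members, and these lie
  in a common element of the chain.\<close>

lemma exists_maximal_distant_cone:
  fixes f :: "'a::normed_lattice"
  assumes "0 \<le> f" "norm f = 1"
  obtains J where "distant_cone f J" "\<And>J'. distant_cone f J' \<Longrightarrow> J \<subseteq> J' \<Longrightarrow> J' = J"
proof -
  have "\<exists>M\<in>Collect (distant_cone f). \<forall>X\<in>Collect (distant_cone f). M \<subseteq> X \<longrightarrow> X = M"
  proof (rule subset_Zorn_nonempty)
    have "distant_cone f {0}"
      using assms by unfold_locales auto
    then show "Collect (distant_cone f) \<noteq> {}" by blast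
  next
    fix C assume C: "C \<noteq> {}" "subset.chain (Collect (distant_cone f)) C"
    then have each: "\<And>J. J \<in> C \<Longrightarrow> distant_cone f J"
      and lin: "\<And>J J'. J \<in> C \<Longrightarrow> J' \<in> C \<Longrightarrow> J \<subseteq> J' \<or> J' \<subseteq> J"
      by (auto simp: subset.chain_def)
    have add: "a + b \<in> \<Union>C" if "a \<in> \<Union>C" "b \<in> \<Union>C" for a b
    proof -
      obtain J J' where J: "a \<in> J" "J \<in> C" "b \<in> J'" "J' \<in> C"
        using \<open>a \<in> \<Union>C\<close> \<open>b \<in> \<Union>C\<close> by blast
      from lin[OF J(2) J(4)] show ?thesis
      proof
        assume "J \<subseteq> J'"
        with J show ?thesis
          using distant_cone.add_mem[OF each[OF J(4)], of a b] by blast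
      next
        assume "J' \<subseteq> J"
        with J show ?thesis
          using distant_cone.add_mem[OF each[OF J(2)], of a b] by blast
      qed
    qed
    show "\<Union>C \<in> Collect (distant_cone f)"
      unfolding mem_Collect_eq
    proof
      show "0 \<in> \<Union>C"
        using C(1) each distant_cone.zero_mem by blast
    next
      fix a b assume "0 \<le> a" "a \<le> b" "b \<in> \<Union>C"
      then show "a \<in> \<Union>C"
        using distant_cone.down_mem[OF each, of _ a b] by blast
    next
      fix a r assume "a \<in> \<Union>C" "(0::real) \<le> r"
      then show "r *\<^sub>R a \<in> \<Union>C"
        using distant_cone.scaleR_mem[OF each, of _ a r] by blast
    qed (use add each in \<open>auto dest: distant_cone.mem_nonneg distant_cone.dist_ge\<close>)
  qed
  then show ?thesis using that by blast
qed

section \<open>Maximal cones: primeness, closedness and the one-dimensional quotient\<close>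

locale maximal_distant_cone = distant_cone f J for f :: "'a::am_space" and J +
  assumes f_nonneg: "0 \<le> f"
    and maximal: "\<And>J'. distant_cone f J' \<Longrightarrow> J \<subseteq> J' \<Longrightarrow> J' = J"
begin

text \<open>For positive s, the positive part of f - j/s is at most y/s, while
  \<open>dist_ge\<close> bounds its norm below by 1. So f keeps norm 1 modulo J; the later estimates
  modulo J reduce to this.\<close>

lemma scale_le_norm:
  assumes "j \<in> J" "0 \<le> y" "s *\<^sub>R f \<le> y + j"
  shows "s \<le> norm y"
proof (cases "s \<le> 0")
  case True
  then show ?thesis using norm_ge_zero[of y] by linarith
next
  case False
  then have s: "0 < s" by simp
  have "inverse s *\<^sub>R (s *\<^sub>R f) \<le> inverse s *\<^sub>R (y + j)"
    using s assms(3) by (intro scaleR_left_mono) auto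
  then have "f - inverse s *\<^sub>R j \<le> inverse s *\<^sub>R y"
    using s by (simp add: algebra_simps)
  then have "pprt (f - inverse s *\<^sub>R j) \<le> inverse s *\<^sub>R y"
    using s assms(2) by (intro pprt_le) (auto simp: scaleR_nonneg_nonneg)
  then have "norm (pprt (f - inverse s *\<^sub>R j)) \<le> norm (inverse s *\<^sub>R y)"
    by (intro norm_mono_nonneg) auto
  moreover have "1 \<le> norm (pprt (f - inverse s *\<^sub>R j))"
    using s assms(1) by (intro dist_ge scaleR_mem) auto
  ultimately have "1 \<le> inverse s * norm y"
    using s by simp
  then show ?thesis
    using s by (simp add: field_simps)
qed

lemma not_mem_near:
  assumes "0 \<le> a" "a \<notin> J"
  obtains r j where "0 \<le> r" "j \<in> J" "norm (pprt (f - (r *\<^sub>R a + j))) < 1"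
proof -
  \<comment> \<open>\<open>J'\<close> is the positive part of the ideal generated by
    \<open>J\<close> and \<open>a\<close>. Being strictly larger than \<open>J\<close>, it must
    violate \<open>dist_ge\<close>, the only condition that can fail.\<close>
  define J' where "J' = {b. 0 \<le> b \<and> (\<exists>r\<ge>0. \<exists>j\<in>J. b \<le> r *\<^sub>R a + j)}"
  have sub: "J \<subseteq> J'"
    unfolding J'_def using mem_nonneg by (fastforce intro: exI[of _ 0])
  have "a \<in> J'"
    unfolding J'_def using assms(1) zero_mem by (auto intro!: exI[of _ 1] bexI[of _ 0])
  then have not: "\<not> distant_cone f J'"
    using maximal sub assms(2) by blast
  have zero: "0 \<in> J'" using sub zero_mem by blast
  have add: "b + c \<in> J'" if bc: "b \<in> J'" "c \<in> J'" for b c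
  proof -
    obtain r j s k where *: "0 \<le> r" "j \<in> J" "b \<le> r *\<^sub>R a + j" "0 \<le> s" "k \<in> J" "c \<le> s *\<^sub>R a + k"
      using bc unfolding J'_def by blast
    have "b + c \<le> (r + s) *\<^sub>R a + (j + k)"
      using add_mono[OF *(3) *(6)] by (simp add: algebra_simps)
    moreover have "0 \<le> b + c"
      using bc by (simp add: J'_def)
    ultimately show ?thesis
      unfolding J'_def using * add_mem[of j k] by (auto intro!: exI[of _ "r + s"])
  qed
  have scale: "s *\<^sub>R b \<in> J'" if b: "b \<in> J'" "0 \<le> s" for b s
  proof -
    obtain r j where *: "0 \<le> r" "j \<in> J" "b \<le> r *\<^sub>R a + j"
      using b unfolding J'_def by blast
    have "s *\<^sub>R b \<le> (s * r) *\<^sub>R a + s *\<^sub>R j"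
      using scaleR_left_mono[OF *(3) b(2)] by (simp add: algebra_simps)
    moreover have "0 \<le> s *\<^sub>R b"
      using b by (simp add: J'_def scaleR_nonneg_nonneg)
    ultimately show ?thesis
      unfolding J'_def using * b(2) scaleR_mem[of j s]
      by (auto intro!: exI[of _ "s * r"])
  qed
  have down: "b \<in> J'" if "0 \<le> b" "b \<le> c" "c \<in> J'" for b c
    using that unfolding J'_def by (auto intro: order_trans)
  have nonneg: "0 \<le> b" if "b \<in> J'" for b
    using that by (simp add: J'_def)
  have "\<exists>b\<in>J'. \<not> 1 \<le> norm (pprt (f - b))"
  proof (rule ccontr)
    assume "\<not> ?thesis"
    then have "distant_cone f J'"
      using zero nonneg add scale by unfold_locales (blast intro: down)+
    with not show False by blast
  qed
  then obtain b where b: "b \<in> J'" "\<not> 1 \<le> norm (pprt (f - b))" by blast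
  then obtain r j where *: "0 \<le> r" "j \<in> J" "b \<le> r *\<^sub>R a + j"
    unfolding J'_def by blast
  have "norm (pprt (f - (r *\<^sub>R a + j))) \<le> norm (pprt (f - b))"
    by (intro norm_mono_nonneg pprt_mono diff_left_mono *(3) zero_le_pprt)
  with * b(2) that show ?thesis by fastforce
qed

text \<open>Otherwise f comes closer than 1 to both t a + l and t b + l for a suitable l in J. As t
  a and t b are disjoint, (f - l)^+ is the supremum of (f - l - t a)^+ and (f - l - t b)^+, so the
  AM-property gives it norm below 1, against \<open>dist_ge\<close>.\<close>

lemma prime:
  assumes "inf a b = 0"
  shows "a \<in> J \<or> b \<in> J"
proof (rule ccontr)
  assume not: "\<not> ?thesis"
  have nonneg: "0 \<le> a" "0 \<le> b"
    using assms by (metis inf_le1, metis inf_le2)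
  obtain r j where r: "0 \<le> r" "j \<in> J" "norm (pprt (f - (r *\<^sub>R a + j))) < 1"
    using not_mem_near[OF nonneg(1)] not by blast
  obtain s k where s: "0 \<le> s" "k \<in> J" "norm (pprt (f - (s *\<^sub>R b + k))) < 1"
    using not_mem_near[OF nonneg(2)] not by blast
  \<comment> \<open>One multiplier \<open>t\<close> and one element \<open>j + k\<close> serve both
    sides, since subtracting more from \<open>f\<close> only shrinks the positive part.\<close>
  define t where "t = max r s"
  have le: "r *\<^sub>R a + j \<le> t *\<^sub>R a + (j + k)" "s *\<^sub>R b + k \<le> t *\<^sub>R b + (j + k)"
    using nonneg mem_nonneg[OF r(2)] mem_nonneg[OF s(2)]
    by (intro add_mono scaleR_right_mono; simp add: t_def)+
  have a: "norm (pprt (f - (t *\<^sub>R a + (j + k)))) < 1"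
    by (rule le_less_trans[OF _ r(3)]) (intro norm_mono_nonneg pprt_mono diff_left_mono le zero_le_pprt)
  have b: "norm (pprt (f - (t *\<^sub>R b + (j + k)))) < 1"
    by (rule le_less_trans[OF _ s(3)]) (intro norm_mono_nonneg pprt_mono diff_left_mono le zero_le_pprt)
  have t: "0 \<le> t" using r by (simp add: t_def)
  have "sup (- (t *\<^sub>R a)) (- (t *\<^sub>R b)) = t *\<^sub>R sup (- a) (- b)"
    using scaleR_sup[OF t, of "- a" "- b"] by simp
  also have "\<dots> = 0"
    using assms neg_inf_eq_sup[of a b] by simp
  finally have "f - (j + k) = (f - (j + k)) + sup (- (t *\<^sub>R a)) (- (t *\<^sub>R b))" by simp
  also have "\<dots> = sup (f - (t *\<^sub>R a + (j + k))) (f - (t *\<^sub>R b + (j + k)))"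
    unfolding add_sup_distrib_left by (simp add: algebra_simps)
  finally have "pprt (f - (j + k)) =
      sup (pprt (f - (t *\<^sub>R a + (j + k)))) (pprt (f - (t *\<^sub>R b + (j + k))))"
    by (simp add: pprt_def sup_assoc sup_left_commute)
  with a b have "norm (pprt (f - (j + k))) < 1"
    by (simp add: norm_sup_eq_max)
  with dist_ge[OF add_mem[OF r(2) s(2)]] show False by simp
qed

text \<open>For a outside J, f is at most r a + j plus a positive element of norm N < 1. Replacing a
  by k + e f leaves (1 - r e) f below an element of norm N modulo J, which
  \<open>scale_le_norm\<close> forbids for small e.\<close>

lemma closed:
  assumes "0 \<le> a" and approx: "\<And>e. 0 < e \<Longrightarrow> \<exists>j\<in>J. a \<le> j + e *\<^sub>R f"
  shows "a \<in> J"
proof (rule ccontr)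
  assume "a \<notin> J"
  then obtain r j where r: "0 \<le> r" "j \<in> J" "norm (pprt (f - (r *\<^sub>R a + j))) < 1"
    using not_mem_near[OF assms(1)] by blast
  define N where "N = norm (pprt (f - (r *\<^sub>R a + j)))"
  \<comment> \<open>The denominator \<open>r + 1\<close> yields \<open>r * e < 1 - N\<close> and
    also covers \<open>r = 0\<close>.\<close>
  define e where "e = (1 - N) / (r + 1)"
  have "N < 1" using r(3) by (simp add: N_def)
  then have e: "0 < e" "r * e < 1 - N"
    using r(1) by (auto simp: e_def field_simps)
  obtain k where k: "k \<in> J" "a \<le> k + e *\<^sub>R f"
    using approx[OF e(1)] by blast
  have "f = (f - (r *\<^sub>R a + j)) + r *\<^sub>R a + j" by simp
  also have "\<dots> \<le> pprt (f - (r *\<^sub>R a + j)) + r *\<^sub>R (k + e *\<^sub>R f) + j"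
    using k(2) r(1) by (intro add_mono le_pprt scaleR_left_mono) auto
  finally have "(1 - r * e) *\<^sub>R f \<le> pprt (f - (r *\<^sub>R a + j)) + (r *\<^sub>R k + j)"
    by (simp add: algebra_simps)
  then have "1 - r * e \<le> N"
    unfolding N_def using r k by (intro scale_le_norm[of "r *\<^sub>R k + j"] add_mem scaleR_mem) auto
  with e show False by simp
qed

text \<open>A Dedekind cut: \<open>t \<in> A\<close> means that t f lies below x modulo J, and by
  primeness every other t has t f above x modulo J. The supremum of \<open>A\<close> has both
  properties because J is closed.\<close>

lemma exists_coordinate: "\<exists>t. labs (x - t *\<^sub>R f) \<in> J"
proof -
  define A where "A = {t. pprt (t *\<^sub>R f - x) \<in> J}"
  have notA: "pprt (x - t *\<^sub>R f) \<in> J" if "t \<notin> A" for t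
    using prime[OF inf_pprt_uminus[of "x - t *\<^sub>R f"]] that by (simp add: A_def)
  have ub: "t \<le> norm x" if "t \<in> A" for t
  proof -
    have "t *\<^sub>R f - x \<le> pprt (t *\<^sub>R f - x)" "x \<le> labs x"
      by (auto simp: le_pprt)
    from add_mono[OF this] have "t *\<^sub>R f \<le> labs x + pprt (t *\<^sub>R f - x)"
      by (simp add: add.commute)
    from scale_le_norm[OF _ labs_nonneg this] show ?thesis
      using that by (simp add: A_def)
  qed
  \<comment> \<open>Otherwise -x, and hence \<open>labs x\<close>, would dominate (norm x + 1) f
    modulo J, contradicting \<open>scale_le_norm\<close>.\<close>
  have "- (norm x + 1) \<in> A"
  proof (rule ccontr)
    let ?t = "- (norm x + 1)"
    assume "?t \<notin> A"
    from notA[OF this] have mem: "pprt (x - ?t *\<^sub>R f) \<in> J" .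
    have "x - ?t *\<^sub>R f \<le> pprt (x - ?t *\<^sub>R f)" "- x \<le> labs x"
      by (auto simp only: le_pprt sup_ge2)
    from add_mono[OF this] have "(norm x + 1) *\<^sub>R f \<le> labs x + pprt (x - ?t *\<^sub>R f)"
      by (simp add: algebra_simps)
    from scale_le_norm[OF mem labs_nonneg this] show False by simp
  qed
  then have ne: "A \<noteq> {}" by blast
  have bdd: "bdd_above A" using ub by (rule bdd_aboveI)
  define s where "s = Sup A"
  have neg: "pprt (s *\<^sub>R f - x) \<in> J"
  proof (rule closed)
    fix e :: real assume e: "0 < e"
    then obtain t where t: "t \<in> A" "s - e < t"
      using less_cSup_iff[OF ne bdd, of "s - e"] by (auto simp: s_def)
    have "s *\<^sub>R f \<le> (t + e) *\<^sub>R f"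
      using t f_nonneg by (intro scaleR_right_mono) auto
    then have "s *\<^sub>R f - x \<le> (t *\<^sub>R f - x) + e *\<^sub>R f"
      by (simp add: algebra_simps)
    also have "\<dots> \<le> pprt (t *\<^sub>R f - x) + e *\<^sub>R f"
      by (simp add: le_pprt)
    finally have "pprt (s *\<^sub>R f - x) \<le> pprt (t *\<^sub>R f - x) + e *\<^sub>R f"
      using e f_nonneg by (intro pprt_le) (auto simp: scaleR_nonneg_nonneg)
    then show "\<exists>j\<in>J. pprt (s *\<^sub>R f - x) \<le> j + e *\<^sub>R f"
      using t by (auto simp: A_def)
  qed simp
  have pos: "pprt (x - s *\<^sub>R f) \<in> J"
  proof (rule closed)
    fix e :: real assume e: "0 < e"
    then have "s + e \<notin> A"
      using cSup_upper[OF _ bdd, of "s + e"] by (auto simp: s_def)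
    then have mem: "pprt (x - (s + e) *\<^sub>R f) \<in> J" by (rule notA)
    have "x - s *\<^sub>R f = (x - (s + e) *\<^sub>R f) + e *\<^sub>R f"
      by (simp add: algebra_simps)
    also have "\<dots> \<le> pprt (x - (s + e) *\<^sub>R f) + e *\<^sub>R f"
      by (simp add: le_pprt)
    finally have "pprt (x - s *\<^sub>R f) \<le> pprt (x - (s + e) *\<^sub>R f) + e *\<^sub>R f"
      using e f_nonneg by (intro pprt_le) (auto simp: scaleR_nonneg_nonneg)
    then show "\<exists>j\<in>J. pprt (x - s *\<^sub>R f) \<le> j + e *\<^sub>R f"
      using mem by blast
  qed simp
  have "labs (x - s *\<^sub>R f) \<le> pprt (x - s *\<^sub>R f) + pprt (s *\<^sub>R f - x)"
  proof (rule sup_least)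
    show "x - s *\<^sub>R f \<le> pprt (x - s *\<^sub>R f) + pprt (s *\<^sub>R f - x)"
      using add_mono[OF le_pprt[of "x - s *\<^sub>R f"] zero_le_pprt[of "s *\<^sub>R f - x"]] by simp
    show "- (x - s *\<^sub>R f) \<le> pprt (x - s *\<^sub>R f) + pprt (s *\<^sub>R f - x)"
      using add_mono[OF zero_le_pprt[of "x - s *\<^sub>R f"] le_pprt[of "s *\<^sub>R f - x"]] by simp
  qed
  then show ?thesis
    using down_mem[OF labs_nonneg _ add_mem[OF pos neg]] by blast
qed

text \<open>The quotient map of F modulo the ideal generated by J, with multiples of f read as real
  numbers. \<open>coordinate_eq\<close> shows that the chosen number is the only possible
  one.\<close>

definition coordinate :: "'a \<Rightarrow> real" where
  "coordinate x = (SOME t. labs (x - t *\<^sub>R f) \<in> J)"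

lemma coordinate_mem: "labs (x - coordinate x *\<^sub>R f) \<in> J"
  unfolding coordinate_def by (rule someI_ex[OF exists_coordinate])

text \<open>Together with \<open>coordinate_mem\<close> the assumption puts a multiple of f below an
  element of J, and \<open>scale_le_norm\<close> with y = 0 makes the factor nonpositive. This and
  \<open>coordinate_ge\<close> let all later identities be checked modulo J.\<close>

lemma coordinate_le:
  assumes "j \<in> J" "t *\<^sub>R f \<le> x + j"
  shows "t \<le> coordinate x"
proof -
  let ?s = "coordinate x"
  have "t *\<^sub>R f \<le> ?s *\<^sub>R f + labs (x - ?s *\<^sub>R f) + j"
    using assms(2) le_labs_diff[of x "?s *\<^sub>R f"] by (meson add_right_mono order_trans)
  then have "(t - ?s) *\<^sub>R f \<le> 0 + (labs (x - ?s *\<^sub>R f) + j)"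
    by (simp add: algebra_simps)
  from scale_le_norm[OF _ _ this] show ?thesis
    using add_mem[OF coordinate_mem assms(1)] by simp
qed

lemma coordinate_ge:
  assumes "j \<in> J" "x \<le> t *\<^sub>R f + j"
  shows "coordinate x \<le> t"
proof -
  let ?s = "coordinate x"
  have "?s *\<^sub>R f \<le> t *\<^sub>R f + j + labs (x - ?s *\<^sub>R f)"
    using assms(2) le_labs_diff'[of "?s *\<^sub>R f" x] by (meson add_right_mono order_trans)
  then have "(?s - t) *\<^sub>R f \<le> 0 + (j + labs (x - ?s *\<^sub>R f))"
    by (simp add: algebra_simps)
  from scale_le_norm[OF _ _ this] show ?thesis
    using add_mem[OF assms(1) coordinate_mem] by simp
qed

lemma coordinate_eq:
  assumes "labs (x - t *\<^sub>R f) \<in> J"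
  shows "coordinate x = t"
  using coordinate_le[OF assms le_labs_diff'] coordinate_ge[OF assms le_labs_diff]
  by (rule antisym[rotated])

lemma coordinate_add: "coordinate (x + y) = coordinate x + coordinate y"
proof (rule coordinate_eq)
  let ?a = "x - coordinate x *\<^sub>R f" and ?b = "y - coordinate y *\<^sub>R f"
  have eq: "x + y - (coordinate x + coordinate y) *\<^sub>R f = ?a + ?b"
    by (simp add: algebra_simps)
  have "labs (?a + ?b) \<le> labs ?a + labs ?b"
  proof (rule sup_least)
    show "?a + ?b \<le> labs ?a + labs ?b" by (intro add_mono sup_ge1)
    have "- ?a + - ?b \<le> labs ?a + labs ?b" by (intro add_mono sup_ge2)
    then show "- (?a + ?b) \<le> labs ?a + labs ?b" by simp
  qed
  then show "labs (x + y - (coordinate x + coordinate y) *\<^sub>R f) \<in> J"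
    unfolding eq by (rule down_mem[OF labs_nonneg _ add_mem[OF coordinate_mem coordinate_mem]])
qed

lemma coordinate_scaleR: "coordinate (r *\<^sub>R x) = r * coordinate x"
proof (rule coordinate_eq)
  let ?a = "x - coordinate x *\<^sub>R f"
  have eq: "r *\<^sub>R x - (r * coordinate x) *\<^sub>R f = r *\<^sub>R ?a"
    by (simp add: algebra_simps)
  show "labs (r *\<^sub>R x - (r * coordinate x) *\<^sub>R f) \<in> J"
    unfolding eq labs_scaleR by (intro scaleR_mem coordinate_mem) simp
qed

lemma coordinate_f: "coordinate f = 1"
  by (rule coordinate_eq) (simp add: zero_mem)

lemma coordinate_mono: "x \<le> y \<Longrightarrow> coordinate x \<le> coordinate y"
  using coordinate_le[OF coordinate_mem[of x], of "coordinate x" y] le_labs_diff'[of "coordinate x *\<^sub>R f" x]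
  by (meson add_right_mono order_trans)

lemma coordinate_sup: "coordinate (sup x y) = max (coordinate x) (coordinate y)"
proof (rule antisym)
  let ?m = "max (coordinate x) (coordinate y)"
  let ?a = "labs (x - coordinate x *\<^sub>R f)" and ?b = "labs (y - coordinate y *\<^sub>R f)"
  have "coordinate x *\<^sub>R f + ?a \<le> ?m *\<^sub>R f + (?a + ?b)" "coordinate y *\<^sub>R f + ?b \<le> ?m *\<^sub>R f + (?a + ?b)"
    using f_nonneg labs_nonneg[of "x - coordinate x *\<^sub>R f"] labs_nonneg[of "y - coordinate y *\<^sub>R f"]
    by (intro add_mono scaleR_right_mono; simp)+
  then have "sup x y \<le> ?m *\<^sub>R f + (?a + ?b)"
    using le_labs_diff[of x "coordinate x *\<^sub>R f"] le_labs_diff[of y "coordinate y *\<^sub>R f"]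
    by (intro sup_least) (meson order_trans)+
  then show "coordinate (sup x y) \<le> ?m"
    by (rule coordinate_ge[OF add_mem[OF coordinate_mem coordinate_mem]])
  show "?m \<le> coordinate (sup x y)"
    by (intro max.boundedI coordinate_mono) auto
qed

lemma abs_coordinate_le: "\<bar>coordinate x\<bar> \<le> norm x"
proof -
  have *: "coordinate y \<le> norm y" for y
  proof (rule scale_le_norm[OF coordinate_mem labs_nonneg, of _ y, simplified norm_labs])
    show "coordinate y *\<^sub>R f \<le> labs y + labs (y - coordinate y *\<^sub>R f)"
      by (meson add_right_mono le_labs_diff' order_trans sup_ge1)
  qed
  show ?thesis
    using *[of x] *[of "- x"] coordinate_scaleR[of "-1" x] by auto
qed

lemma linear_coordinate: "linear coordinate"
  by (rule linearI) (simp_all add: coordinate_add coordinate_scaleR)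

lemma vector_lattice_hom_coordinate: "vector_lattice_hom coordinate"
  unfolding vector_lattice_hom_def
proof (intro conjI allI)
  show "coordinate (sup x y) = sup (coordinate x) (coordinate y)" for x y
    by (simp add: coordinate_sup sup_max)
  show "coordinate (inf x y) = inf (coordinate x) (coordinate y)" for x y
  proof -
    have "coordinate (inf x y) = - max (- coordinate x) (- coordinate y)"
      by (simp only: inf_eq_neg_sup[of x y] linear_neg[OF linear_coordinate] coordinate_sup)
    then show ?thesis by (simp add: inf_min)
  qed
qed (rule linear_coordinate)

end

lemma topspace_K_top: "topspace K_top = {x. vector_lattice_hom (blinfun_apply x) \<and> norm x \<le> 1}"
  by (simp add: K_top_def strong_operator_topology_topspace)

lemma exists_norming_lattice_hom:
  fixes f :: "'a::am_space"
  assumes "0 \<le> f" "norm f = 1"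
  obtains x :: "'a \<Rightarrow>\<^sub>L real" where "x \<in> topspace K_top" "blinfun_apply x f = 1"
proof -
  obtain J where J: "distant_cone f J" "\<And>J'. distant_cone f J' \<Longrightarrow> J \<subseteq> J' \<Longrightarrow> J' = J"
    using exists_maximal_distant_cone[OF assms] by blast
  interpret maximal_distant_cone f J
    by (intro maximal_distant_cone.intro maximal_distant_cone_axioms.intro J assms)
  have bl: "bounded_linear coordinate"
    using abs_coordinate_le
    by (intro bounded_linear_intro[of _ 1]) (simp_all add: coordinate_add coordinate_scaleR)
  have "norm (Blinfun coordinate) \<le> 1"
    by (rule norm_blinfun_bound) (auto simp: bounded_linear_Blinfun_apply[OF bl] abs_coordinate_le)
  then show ?thesis
    using that[of "Blinfun coordinate"]
    by (simp add: topspace_K_top bounded_linear_Blinfun_apply[OF bl] coordinate_f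
        vector_lattice_hom_coordinate)
qed

text \<open>After normalising f, a norming homomorphism attains its norm. This is the nontrivial
  half of the isometry of evaluation.\<close>

lemma norm_le_if_evaluation_le:
  fixes f :: "'a::am_space"
  assumes "0 \<le> f" "0 \<le> c" and le: "\<And>x. x \<in> topspace K_top \<Longrightarrow> blinfun_apply x f \<le> c"
  shows "norm f \<le> c"
proof (cases "f = 0")
  case False
  define g where "g = (1 / norm f) *\<^sub>R f"
  have "0 \<le> g" "norm g = 1"
    using False assms(1) by (auto simp: g_def scaleR_nonneg_nonneg)
  then obtain x :: "'a \<Rightarrow>\<^sub>L real" where "x \<in> topspace K_top" "blinfun_apply x g = 1"
    by (rule exists_norming_lattice_hom)
  then show ?thesis
    using False le[of x] by (simp add: g_def blinfun.scaleR_right)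
qed (simp add: assms)

section \<open>The evaluation map\<close>

context
  fixes x :: "'a::normed_lattice \<Rightarrow>\<^sub>L real"
  assumes x: "x \<in> topspace K_top"
begin

lemma K_top_sup: "blinfun_apply x (sup f g) = max (blinfun_apply x f) (blinfun_apply x g)"
  and K_top_inf: "blinfun_apply x (inf f g) = min (blinfun_apply x f) (blinfun_apply x g)"
  using x by (auto simp: topspace_K_top vector_lattice_hom_def sup_max inf_min)

lemma K_top_pprt: "blinfun_apply x (pprt f) = max (blinfun_apply x f) 0"
  by (simp add: pprt_def K_top_sup)

lemma K_top_labs: "blinfun_apply x (labs f) = \<bar>blinfun_apply x f\<bar>"
  by (simp add: K_top_sup blinfun.minus_right)

lemma K_top_mono: "f \<le> g \<Longrightarrow> blinfun_apply x f \<le> blinfun_apply x g"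
  using K_top_sup[of f g] by (simp add: sup_absorb2)

lemma K_top_nonneg: "0 \<le> f \<Longrightarrow> 0 \<le> blinfun_apply x f"
  using K_top_mono[of 0 f] by simp

lemma K_top_abs_le_norm: "\<bar>blinfun_apply x f\<bar> \<le> norm f"
proof -
  have "norm x * norm f \<le> 1 * norm f"
    using x by (intro mult_right_mono) (auto simp: topspace_K_top)
  with norm_blinfun[of x f] show ?thesis by simp
qed

text \<open>Needed for the points \<open>norm x *\<^sub>R y\<close>: peak functions can locate x
  only up to its norm.\<close>

lemma K_top_scaleR: "0 \<le> t \<Longrightarrow> t \<le> 1 \<Longrightarrow> t *\<^sub>R x \<in> topspace K_top"
  using x by (auto simp: topspace_K_top vector_lattice_hom_def sup_max inf_min blinfun.scaleR_left
      max_mult_distrib_left min_mult_distrib_left mult_le_one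
      intro!: linearI blinfun.add_right simp: algebra_simps blinfun.add_right blinfun.scaleR_right)

end

text \<open>For the direction from left to right, the norm bound with c = 0 is applied to the
  positive part of f - g. Infima in F and in the range of \<open>evaluation\<close> therefore
  correspond.\<close>

lemma evaluation_le_iff:
  fixes f g :: "'a::am_space"
  shows "evaluation f \<le> evaluation g \<longleftrightarrow> f \<le> g"
proof
  assume le: "evaluation f \<le> evaluation g"
  have "norm (pprt (f - g)) \<le> 0"
  proof (rule norm_le_if_evaluation_le)
    fix x :: "'a \<Rightarrow>\<^sub>L real" assume x: "x \<in> topspace K_top"
    with le_funD[OF le, of x] show "blinfun_apply x (pprt (f - g)) \<le> 0"
      by (simp add: evaluation_def K_top_pprt[OF x] blinfun.diff_right)
  qed auto
  then have "pprt (f - g) = 0" by simp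
  with le_pprt[of "f - g"] show "f \<le> g" by simp
qed (auto simp: evaluation_def le_fun_def K_top_mono)

lemma evaluation_mem_C_of: "evaluation f \<in> C_of K_top"
proof -
  have "continuous_map K_top euclideanreal (\<lambda>x. blinfun_apply x f)"
    unfolding K_top_def
    by (intro continuous_map_from_subtopology strong_operator_topology_continuous_evaluation)
  then have "continuous_map K_top euclideanreal (evaluation f)"
    by (rule continuous_map_eq) (simp add: evaluation_def)
  then show ?thesis by (simp add: C_of_def evaluation_def)
qed

lemma evaluation_zero: "evaluation 0 = (\<lambda>_. 0)"
  by (auto simp: evaluation_def)

lemma evaluation_inf: "evaluation (inf f g) = inf (evaluation f) (evaluation g)"
  by (auto simp: evaluation_def K_top_inf inf_min)

lemma vector_sublattice_evaluation:
  "vector_sublattice (range (evaluation :: 'a::normed_lattice \<Rightarrow> _)) (C_of K_top)"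
  unfolding vector_sublattice_def
proof (intro conjI ballI allI)
  show "range (evaluation :: 'a \<Rightarrow> _) \<subseteq> C_of K_top"
    using evaluation_mem_C_of by blast
  show "(\<lambda>_. 0) \<in> range (evaluation :: 'a \<Rightarrow> _)"
    by (rule image_eqI[of _ _ 0]) (simp_all add: evaluation_zero)
  fix f g :: "('a \<Rightarrow>\<^sub>L real) \<Rightarrow> real"
  assume f: "f \<in> range evaluation"
  then obtain a where a: "f = evaluation a" by blast
  show "(\<lambda>x. c * f x) \<in> range evaluation" for c
    by (rule image_eqI[of _ _ "c *\<^sub>R a"]) (auto simp: a evaluation_def blinfun.scaleR_right)
  assume g: "g \<in> range evaluation"
  then obtain b where b: "g = evaluation b" by blast
  show "(\<lambda>x. f x + g x) \<in> range evaluation"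
    by (rule image_eqI[of _ _ "a + b"]) (auto simp: a b evaluation_def blinfun.add_right)
  show "sup f g \<in> range evaluation"
    by (rule image_eqI[of _ _ "sup a b"]) (auto simp: a b evaluation_def K_top_sup sup_max)
  show "inf f g \<in> range evaluation"
    by (rule image_eqI[of _ _ "inf a b"]) (auto simp: a b evaluation_inf)
qed

lemma isGlb_iff:
  "isGlb E P a \<longleftrightarrow> a \<in> E \<and> (\<forall>p\<in>P. a \<le> p) \<and> (\<forall>h\<in>E. (\<forall>p\<in>P. h \<le> p) \<longrightarrow> h \<le> a)"
  by (auto simp: isGlb_def greatestP_def isLb_def setge_def setle_def)

lemma isLub_iff:
  "isLub E P a \<longleftrightarrow> a \<in> E \<and> (\<forall>p\<in>P. p \<le> a) \<and> (\<forall>h\<in>E. (\<forall>p\<in>P. p \<le> h) \<longrightarrow> a \<le> h)"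
  by (auto simp: isLub_def leastP_def isUb_def setge_def setle_def)

section \<open>From regularity to semicontinuity\<close>

lemma semicontinuous_if_regular:
  assumes "regular_sublattice (range (evaluation :: 'a::am_space \<Rightarrow> ('a \<Rightarrow>\<^sub>L real) \<Rightarrow> real)) (C_of K_top)"
  shows "semicontinuous TYPE('a)"
  unfolding semicontinuous_def
proof (intro allI impI)
  fix P :: "'a set" and f
  assume *: "(\<forall>p\<in>P. 0 \<le> p \<and> norm p \<le> 1) \<and> upward_directed P \<and> isLub UNIV P f"
  then have P: "\<And>p. p \<in> P \<Longrightarrow> 0 \<le> p" "\<And>p. p \<in> P \<Longrightarrow> norm p \<le> 1" "P \<noteq> {}"
    and f: "\<And>p. p \<in> P \<Longrightarrow> p \<le> f" "\<And>h. (\<And>p. p \<in> P \<Longrightarrow> p \<le> h) \<Longrightarrow> f \<le> h"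
    by (auto simp: upward_directed_def isLub_iff)
  define Q where "Q = (\<lambda>p. evaluation (f - p)) ` P"
  have "isGlb (range evaluation) Q (\<lambda>_. 0)"
    unfolding isGlb_iff evaluation_zero[symmetric] Q_def
  proof (intro conjI ballI impI rangeI)
    fix q assume "q \<in> (\<lambda>p. evaluation (f - p)) ` P"
    then show "evaluation 0 \<le> q"
      using f(1) by (auto simp: evaluation_le_iff)
  next
    fix h :: "('a \<Rightarrow>\<^sub>L real) \<Rightarrow> real" assume "h \<in> range evaluation" and le: "\<forall>q\<in>(\<lambda>p. evaluation (f - p)) ` P. h \<le> q"
    then obtain k where k: "h = evaluation k" by blast
    \<comment> \<open>If k is a lower bound of f - P, then f - k is an upper bound of P, and f is
      the least one.\<close>
    have "f \<le> f - k"
    proof (rule f(2))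
      fix p assume "p \<in> P"
      then have "k \<le> f - p"
        using le by (simp add: k evaluation_le_iff)
      then show "p \<le> f - k" by (simp add: le_diff_eq add.commute)
    qed
    then show "h \<le> evaluation 0"
      by (simp add: k evaluation_le_iff)
  qed
  then have glb: "isGlb (C_of K_top) Q (\<lambda>_. 0)"
    using assms[unfolded regular_sublattice_def, THEN conjunct2, rule_format, of Q] P(3)
    by (auto simp: Q_def)
  \<comment> \<open>This is (f - 1)^+ on K, with the constant 1 extended by 0 as in
    \<open>C_of\<close>. It lies below f - p because p is at most 1 and at most f on K.\<close>
  define g where "g = (\<lambda>x. max (evaluation f x - (if x \<in> topspace K_top then 1 else 0)) 0)"
  have "continuous_map K_top euclideanreal (\<lambda>x. max (evaluation f x - 1) 0)"
    using evaluation_mem_C_of[of f] by (intro continuous_intros) (auto simp: C_of_def)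
  then have "continuous_map K_top euclideanreal g"
    by (rule continuous_map_eq) (simp add: g_def)
  then have "g \<in> C_of K_top"
    by (auto simp: C_of_def g_def evaluation_def)
  moreover have "g \<le> evaluation (f - p)" if p: "p \<in> P" for p
  proof (rule le_funI)
    fix x
    show "g x \<le> evaluation (f - p) x"
    proof (cases "x \<in> topspace K_top")
      case True
      have "blinfun_apply x p \<le> 1"
        using K_top_abs_le_norm[OF True, of p] P(2)[OF p] by linarith
      moreover have "blinfun_apply x p \<le> blinfun_apply x f"
        using K_top_mono[OF True f(1)[OF p]] .
      ultimately show ?thesis
        using True by (simp add: g_def evaluation_def blinfun.diff_right)
    qed (simp add: g_def evaluation_def)
  qed
  ultimately have g: "g \<le> (\<lambda>_. 0)"
    using glb unfolding isGlb_iff Q_def by blast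
  show "norm f \<le> 1"
  proof (rule norm_le_if_evaluation_le)
    show "0 \<le> f" using P f(1) by (metis all_not_in_conv order_trans)
    fix x :: "'a \<Rightarrow>\<^sub>L real" assume "x \<in> topspace K_top"
    with le_funD[OF g, of x] show "blinfun_apply x f \<le> 1"
      by (simp add: g_def evaluation_def)
  qed simp
qed

section \<open>Regularity from semicontinuity\<close>

text \<open>The topology is pulled back from a product topology, whose basic open sets restrict
  finitely many coordinates; the least of the finitely many radii serves for all of them.\<close>

lemma K_top_neighbourhood:
  fixes V :: "('a::normed_lattice \<Rightarrow>\<^sub>L real) set"
  assumes "openin K_top V" "x \<in> V"
  obtains I d where "finite I" "0 < d"
    "\<And>y. y \<in> topspace K_top \<Longrightarrow> (\<And>i. i \<in> I \<Longrightarrow> \<bar>blinfun_apply y i - blinfun_apply x i\<bar> < d) \<Longrightarrow> y \<in> V"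
proof -
  obtain T where T: "openin strong_operator_topology T" "V = T \<inter> topspace K_top"
    using assms(1) unfolding K_top_def
    by (auto simp: openin_subtopology strong_operator_topology_topspace)
  then obtain U where U: "open U" "T = blinfun_apply -` U"
    unfolding strong_operator_topology_def by (auto simp: openin_pullback_topology)
  have "openin (product_topology (\<lambda>_. euclideanreal) UNIV) U" "blinfun_apply x \<in> U"
    using U T assms(2) by (auto simp: open_fun_def)
  from product_topology_open_contains_basis[OF this]
  obtain X where X: "blinfun_apply x \<in> (\<Pi>\<^sub>E i\<in>UNIV. X i)" "\<And>i. open (X i)"
    "finite {i. X i \<noteq> UNIV}" "(\<Pi>\<^sub>E i\<in>UNIV. X i) \<subseteq> U"
    by auto
  have "\<exists>e>0. \<forall>t. \<bar>t - blinfun_apply x i\<bar> < e \<longrightarrow> t \<in> X i" for i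
    using X(1) X(2)[of i] by (auto simp: open_real PiE_iff)
  then obtain e where e: "\<And>i. 0 < e i" "\<And>i t. \<bar>t - blinfun_apply x i\<bar> < e i \<Longrightarrow> t \<in> X i"
    by metis
  let ?I = "{i. X i \<noteq> UNIV}"
  \<comment> \<open>The inserted 1 provides a radius when no coordinate is restricted.\<close>
  define d where "d = Min (insert 1 (e ` ?I))"
  have "y \<in> V" if y: "y \<in> topspace K_top"
    "\<And>i. i \<in> ?I \<Longrightarrow> \<bar>blinfun_apply y i - blinfun_apply x i\<bar> < d" for y
  proof -
    have "blinfun_apply y i \<in> X i" for i
    proof (cases "i \<in> ?I")
      case True
      then have "d \<le> e i" using X(3) by (simp add: d_def)
      with y(2)[OF True] e(2)[of "blinfun_apply y i" i] show ?thesis by linarith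
    qed simp
    then have "blinfun_apply y \<in> U" using X(4) by (auto simp: PiE_iff)
    then show ?thesis using T U y(1) by simp
  qed
  moreover have "0 < d" using X(3) e(1) by (simp add: d_def)
  ultimately show ?thesis using that X(3) by blast
qed

text \<open>With \<open>x\<^sub>0 = x / \<parallel>x\<parallel>\<close> and \<open>w\<close> almost norming \<open>x\<^sub>0\<close>, take \<open>u\<close> to be the positive part of
  \<open>w - \<Sum>i\<in>I. \<bar>i - (x\<^sub>0 i / x\<^sub>0 w) w\<bar>\<close>.\<close>

lemma exists_peak:
  fixes x :: "'a::normed_lattice \<Rightarrow>\<^sub>L real"
  assumes x: "x \<in> topspace K_top" "x \<noteq> 0" and "finite I" "0 < d"
  obtains u b where "0 \<le> u" "norm u \<le> 1" "0 < b" "b < norm u"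
    "\<And>y i. y \<in> topspace K_top \<Longrightarrow> b < blinfun_apply y u \<Longrightarrow> i \<in> I \<Longrightarrow>
       \<bar>norm x * blinfun_apply y i - blinfun_apply x i\<bar> < d"
proof -
  define t where "t = norm x"
  have t: "0 < t" "t \<le> 1" using x by (auto simp: t_def topspace_K_top)
  define M where "M = (\<Sum>i\<in>I. norm i)"
  have M: "0 \<le> M" "\<And>i. i \<in> I \<Longrightarrow> norm i \<le> M"
    unfolding M_def using assms(3) by (auto intro: sum_nonneg member_le_sum)
  \<comment> \<open>The bound 1/4 keeps \<open>1 - 2 * \<eta>\<close> positive and \<open>c\<close>
    above 1/2; the other bound makes the final error \<open>4 * \<eta> * (1 + M)\<close> smaller
    than \<open>d\<close>.\<close>
  define \<eta> where "\<eta> = min (1/4) (d / (8 * (1 + M)))"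
  have \<eta>: "0 < \<eta>" "\<eta> \<le> 1/4"
    using assms(4) M(1) unfolding \<eta>_def by simp (rule min.cobounded1)
  have "\<eta> \<le> d / (8 * (1 + M))" by (simp add: \<eta>_def)
  then have "\<eta> * (8 * (1 + M)) \<le> d" using M(1) by (simp add: field_simps)
  then have \<eta>d: "4 * \<eta> * (1 + M) < d" using assms(4) by (simp add: algebra_simps)
  have "\<exists>w. (1 - \<eta>) * t * norm w < \<bar>blinfun_apply x w\<bar>"
  proof (rule ccontr)
    assume "\<not> ?thesis"
    then have "norm x \<le> (1 - \<eta>) * t"
      using \<eta> t by (intro norm_blinfun_bound) (auto simp: not_less)
    then show False using \<eta> t by (simp add: t_def)
  qed
  then obtain v where v: "(1 - \<eta>) * t * norm v < \<bar>blinfun_apply x v\<bar>" by blast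
  then have "v \<noteq> 0" by (auto simp: blinfun.zero_right)
  \<comment> \<open>Passing to the modulus keeps the norm of v, and the lattice homomorphism x takes
    the value |x v| there. So c, the value of x / norm x at w, exceeds
    \<open>1 - \<eta>\<close>.\<close>
  define w where "w = (1 / norm v) *\<^sub>R labs v"
  define c where "c = blinfun_apply x w / t"
  have w: "0 \<le> w" "norm w = 1"
    using \<open>v \<noteq> 0\<close> by (auto simp: w_def labs_nonneg scaleR_nonneg_nonneg)
  have c: "1 - \<eta> < c" "c \<le> 1"
  proof -
    have "c = \<bar>blinfun_apply x v\<bar> / (norm v * t)"
      by (simp add: c_def w_def blinfun.scaleR_right K_top_labs[OF x(1)])
    then have "(1 - \<eta>) * (t * norm v) < c * (t * norm v)"
      using v t \<open>v \<noteq> 0\<close> by (simp add: mult.assoc mult.commute[of t])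
    then show "1 - \<eta> < c"
      using t by (simp add: mult_less_cancel_right)
    have "\<bar>blinfun_apply x w\<bar> \<le> t"
      using norm_blinfun[of x w] w by (simp add: t_def)
    then show "c \<le> 1"
      using t by (simp add: c_def)
  qed
  define a where "a i = blinfun_apply x i / t" for i
  have a: "\<bar>a i\<bar> \<le> M" if "i \<in> I" for i
  proof -
    have "\<bar>blinfun_apply x i\<bar> \<le> t * norm i"
      using norm_blinfun[of x i] by (simp add: t_def)
    then have "\<bar>a i\<bar> \<le> norm i"
      using t by (simp add: a_def field_simps)
    with M(2)[OF that] show ?thesis by linarith
  qed
  \<comment> \<open>\<open>s\<close> vanishes at x; at other points it measures the failure of
    proportionality to x on \<open>I\<close>.\<close>
  define s where "s = (\<Sum>i\<in>I. labs (i - (a i / c) *\<^sub>R w))"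
  have s: "0 \<le> s" unfolding s_def by (intro sum_nonneg labs_nonneg)
  have ys: "blinfun_apply y s = (\<Sum>i\<in>I. \<bar>blinfun_apply y i - a i / c * blinfun_apply y w\<bar>)"
    if "y \<in> topspace K_top" for y
    by (simp add: s_def blinfun.sum_right K_top_labs[OF that] blinfun.diff_right blinfun.scaleR_right
        del: minus_diff_eq)
  define u where "u = pprt (w - s)"
  have u_le: "u \<le> w" unfolding u_def using s w by (intro pprt_le) auto
  show ?thesis
  proof
    show "0 \<le> u" by (simp add: u_def)
    show "norm u \<le> 1"
      using norm_mono_nonneg[OF \<open>0 \<le> u\<close> u_le] w by simp
    show "0 < 1 - 2 * \<eta>" using \<eta> by simp
    have "a i / c * blinfun_apply x w = blinfun_apply x i" for i
    proof -
      have "blinfun_apply x w = c * t" "c \<noteq> 0" using t c \<eta> by (auto simp: c_def)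
      then show ?thesis using t by (simp add: a_def)
    qed
    then have "blinfun_apply x s = 0"
      by (simp add: ys[OF x(1)])
    then have "c * t \<le> blinfun_apply x u"
      using t by (simp add: u_def K_top_pprt[OF x(1)] blinfun.diff_right c_def)
    also have "\<dots> \<le> t * norm u"
      using norm_blinfun[of x u] by (simp add: t_def)
    finally have "c \<le> norm u" using t by (simp add: mult.commute)
    with c \<eta> show "1 - 2 * \<eta> < norm u" by simp
    fix y i assume y: "y \<in> topspace K_top" "1 - 2 * \<eta> < blinfun_apply y u" and i: "i \<in> I"
    let ?y = "blinfun_apply y"
    have yw: "?y w \<le> 1" using K_top_abs_le_norm[OF y(1), of w] w by simp
    have s0: "0 \<le> ?y s" by (rule K_top_nonneg[OF y(1) s])
    \<comment> \<open>Since y w is at most 1 and y s is nonnegative, a value of u this large forces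
      y w close to 1 and y s close to 0.\<close>
    have "1 - 2 * \<eta> < ?y w - ?y s"
      using y(2) \<eta> by (auto simp: u_def K_top_pprt[OF y(1)] blinfun.diff_right max_def split: if_splits)
    then have yw': "1 - 2 * \<eta> < ?y w" and "?y s < 2 * \<eta>"
      using s0 yw by linarith+
    moreover have "\<bar>?y i - a i / c * ?y w\<bar> \<le> ?y s"
      unfolding ys[OF y(1)] using i assms(3)
      by (intro member_le_sum[of i I "\<lambda>i. \<bar>?y i - a i / c * ?y w\<bar>"]) auto
    ultimately have 1: "\<bar>?y i - a i / c * ?y w\<bar> < 2 * \<eta>" by linarith
    \<comment> \<open>The second half of a triangle inequality: y w and c both lie above
      \<open>1 - 2 * \<eta>\<close> and are at most 1, and c is above 1/2. With the first half the
      total error is below \<open>2 * \<eta> + 4 * \<eta> * M\<close>.\<close>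
    have "\<bar>a i / c * ?y w - a i\<bar> = \<bar>a i\<bar> / c * \<bar>?y w - c\<bar>"
    proof -
      have "a i / c * ?y w - a i = a i / c * (?y w - c)"
        using c \<eta> by (simp add: field_simps)
      then show ?thesis using c \<eta> by (simp add: abs_mult)
    qed
    also have "\<dots> \<le> (2 * M) * (2 * \<eta>)"
    proof (rule mult_mono)
      have "M \<le> 2 * M * c"
        using mult_left_mono[of "1/2" c "2 * M"] c \<eta> M by simp
      with a[OF i] show "\<bar>a i\<bar> / c \<le> 2 * M"
        using c \<eta> by (simp add: field_simps)
      show "\<bar>?y w - c\<bar> \<le> 2 * \<eta>"
        using yw yw' c \<eta> by linarith
    qed (use M in auto)
    finally have "\<bar>?y i - a i\<bar> < 4 * \<eta> * (1 + M)"
      using 1 \<eta>(1) by (simp add: algebra_simps)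
    then have "\<bar>?y i - a i\<bar> < d" using \<eta>d by linarith
    moreover have "norm x * ?y i - blinfun_apply x i = t * (?y i - a i)"
      using t by (simp add: a_def t_def[symmetric] field_simps)
    moreover have "t * \<bar>?y i - a i\<bar> \<le> \<bar>?y i - a i\<bar>"
      using t by (simp add: mult_left_le_one_le)
    ultimately show "\<bar>norm x * ?y i - blinfun_apply x i\<bar> < d"
      using t by (simp add: abs_mult)
  qed
qed

text \<open>Scaling by \<open>1 / b\<close> is an order automorphism carrying the ball of radius b
  to the unit ball.\<close>

lemma semicontinuous_norm_le:
  fixes D :: "'a::normed_lattice set"
  assumes "semicontinuous TYPE('a)" "upward_directed D" "isLub UNIV D u" "0 < b"
    and D: "\<And>d. d \<in> D \<Longrightarrow> 0 \<le> d" "\<And>d. d \<in> D \<Longrightarrow> norm d \<le> b"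
  shows "norm u \<le> b"
proof -
  let ?s = "\<lambda>d::'a. (1 / b) *\<^sub>R d"
  have s: "?s d \<le> e \<longleftrightarrow> d \<le> b *\<^sub>R e" for d e
    using pos_divideR_le_eq[OF assms(4), of d e] by (simp add: divide_inverse)
  have "isLub UNIV (?s ` D) (?s u)"
    using assms(3,4) by (auto simp: isLub_iff s)
  moreover have "upward_directed (?s ` D)"
    using assms(2,4) by (auto simp: upward_directed_def s)
  moreover have "\<forall>p\<in>?s ` D. 0 \<le> p \<and> norm p \<le> 1"
    using D assms(4) by (auto simp: scaleR_nonneg_nonneg)
  ultimately have "norm (?s u) \<le> 1"
    using assms(1) unfolding semicontinuous_def by blast
  then show ?thesis using assms(4) by simp
qed

text \<open>For an upper bound h of the truncations, (u - h)/r is a lower bound of Q and hence at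
  most 0.\<close>

lemma isLub_pprt_diff:
  fixes Q :: "'a::normed_lattice set"
  assumes glb: "isGlb UNIV Q 0" and "0 \<le> u" "0 < r"
  shows "isLub UNIV ((\<lambda>p. pprt (u - r *\<^sub>R p)) ` Q) u"
  unfolding isLub_iff
proof (intro conjI ballI impI UNIV_I)
  fix d assume "d \<in> (\<lambda>p. pprt (u - r *\<^sub>R p)) ` Q"
  then obtain p where "p \<in> Q" "d = pprt (u - r *\<^sub>R p)" by blast
  moreover have "0 \<le> r *\<^sub>R p"
    using glb \<open>p \<in> Q\<close> assms(3) by (auto simp: isGlb_iff intro!: scaleR_nonneg_nonneg)
  ultimately show "d \<le> u" using assms(2) by (auto intro!: pprt_le)
next
  fix h assume h: "\<forall>d\<in>(\<lambda>p. pprt (u - r *\<^sub>R p)) ` Q. d \<le> h"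
  have "(1 / r) *\<^sub>R (u - h) \<le> p" if "p \<in> Q" for p
  proof -
    have "u - r *\<^sub>R p \<le> h"
      using h that le_pprt order_trans by blast
    then have "u - h \<le> r *\<^sub>R p" by (simp add: algebra_simps)
    then show ?thesis
      using pos_divideR_le_eq[OF assms(3), of "u - h" p] by (simp add: divide_inverse)
  qed
  then have "(1 / r) *\<^sub>R (u - h) \<le> 0"
    using glb by (auto simp: isGlb_iff)
  then show "u \<le> h"
    using pos_divideR_le_eq[OF assms(3), of "u - h" 0] by (simp add: divide_inverse)
qed

lemma regular_if_semicontinuous:
  assumes sc: "semicontinuous TYPE('a::am_space)"
  shows "regular_sublattice (range (evaluation :: 'a \<Rightarrow> ('a \<Rightarrow>\<^sub>L real) \<Rightarrow> real)) (C_of K_top)"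
  unfolding regular_sublattice_def
proof (intro conjI allI impI vector_sublattice_evaluation)
  fix P :: "(('a \<Rightarrow>\<^sub>L real) \<Rightarrow> real) set"
  assume P: "P \<subseteq> range evaluation \<and> P \<noteq> {} \<and> isGlb (range evaluation) P (\<lambda>_. 0)"
  show "isGlb (C_of K_top) P (\<lambda>_. 0)"
    unfolding isGlb_iff
  proof (intro conjI ballI impI)
    show "(\<lambda>_. 0) \<in> C_of K_top" by (simp add: C_of_def)
    show "(\<lambda>_. 0) \<le> p" if "p \<in> P" for p using P that by (auto simp: isGlb_iff)
    fix g :: "('a \<Rightarrow>\<^sub>L real) \<Rightarrow> real"
    assume g: "g \<in> C_of K_top" and gP: "\<forall>p\<in>P. g \<le> p"
    show "g \<le> (\<lambda>_. 0)"
    proof (rule ccontr)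
      assume "\<not> g \<le> (\<lambda>_. 0)"
      then obtain x where gx: "0 < g x" by (auto simp: le_fun_def not_le)
      then have x: "x \<in> topspace K_top"
        using g by (auto simp: C_of_def)
      \<comment> \<open>\<open>P\<close> need not be directed. \<open>Q\<close> is closed under
        binary infima, still lies above g, and contains all preimages of members of
        \<open>P\<close>, so its infimum is 0 as well.\<close>
      define Q where "Q = {q. 0 \<le> q \<and> g \<le> evaluation q}"
      have PQ: "q \<in> Q" if "evaluation q \<in> P" for q
        using that P gP evaluation_le_iff[of 0 q] by (auto simp: Q_def isGlb_iff evaluation_zero)
      obtain q where "q \<in> Q" using P PQ by blast
      have Qinf: "inf p q \<in> Q" if "p \<in> Q" "q \<in> Q" for p q
        using that by (auto simp: Q_def evaluation_inf)
      have glb: "isGlb UNIV Q 0"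
        unfolding isGlb_iff
      proof (intro conjI ballI impI UNIV_I)
        fix h assume "\<forall>q\<in>Q. h \<le> q"
        then have "evaluation h \<le> p" if "p \<in> P" for p
          using that P PQ by (auto simp: evaluation_le_iff)
        then have "evaluation h \<le> evaluation 0"
          using P by (auto simp: isGlb_iff evaluation_zero)
        then show "h \<le> 0" by (simp add: evaluation_le_iff)
      qed (simp add: Q_def)
      \<comment> \<open>Every evaluation vanishes at the zero functional, whereas g is positive at x
        and lies below an evaluation.\<close>
      have "x \<noteq> 0"
        using \<open>q \<in> Q\<close> gx x le_funD[of g "evaluation q" x]
        by (auto simp: Q_def evaluation_def blinfun.zero_left)
      define V where "V = {y \<in> topspace K_top. g y \<in> {g x / 2 <..}}"
      have "openin K_top V"
        unfolding V_def using g by (intro openin_continuous_map_preimage) (auto simp: C_of_def)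
      moreover have "x \<in> V" using x gx by (simp add: V_def)
      ultimately obtain I d where I: "finite I" "0 < d" and
        V: "\<And>y. y \<in> topspace K_top \<Longrightarrow> (\<And>i. i \<in> I \<Longrightarrow> \<bar>blinfun_apply y i - blinfun_apply x i\<bar> < d) \<Longrightarrow> y \<in> V"
        by (rule K_top_neighbourhood) blast
      obtain u b where u: "0 \<le> u" "norm u \<le> 1" and b: "0 < b" "b < norm u"
        and peak: "\<And>y i. y \<in> topspace K_top \<Longrightarrow> b < blinfun_apply y u \<Longrightarrow> i \<in> I \<Longrightarrow>
          \<bar>norm x * blinfun_apply y i - blinfun_apply x i\<bar> < d"
        using exists_peak[OF x \<open>x \<noteq> 0\<close> I] by blast
      \<comment> \<open>Chosen so that a value of p above g x / 2 becomes at least 1 after scaling,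
        hence at least the value of u.\<close>
      define r where "r = 2 / g x"
      have r: "0 < r" using gx by (simp add: r_def)
      define D where "D = (\<lambda>p. pprt (u - r *\<^sub>R p)) ` Q"
      have "norm u \<le> b"
      proof (rule semicontinuous_norm_le[OF sc])
        show "isLub UNIV D u"
          unfolding D_def by (rule isLub_pprt_diff[OF glb u(1) r])
        show "upward_directed D"
          unfolding upward_directed_def
        proof (intro conjI ballI)
          show "D \<noteq> {}" using \<open>q \<in> Q\<close> by (auto simp: D_def)
          fix d e assume "d \<in> D" "e \<in> D"
          then obtain p q where pq: "p \<in> Q" "d = pprt (u - r *\<^sub>R p)" "q \<in> Q" "e = pprt (u - r *\<^sub>R q)"
            by (auto simp: D_def)
          show "\<exists>k\<in>D. d \<le> k \<and> e \<le> k"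
          proof (intro bexI conjI)
            show "pprt (u - r *\<^sub>R inf p q) \<in> D" using Qinf pq by (auto simp: D_def)
            show "d \<le> pprt (u - r *\<^sub>R inf p q)" "e \<le> pprt (u - r *\<^sub>R inf p q)"
              unfolding pq using r by (intro pprt_mono diff_left_mono scaleR_left_mono; simp)+
          qed
        qed
        show "0 < b" by fact
        show "0 \<le> d" if "d \<in> D" for d using that by (auto simp: D_def)
        show "norm d \<le> b" if "d \<in> D" for d
        proof (rule norm_le_if_evaluation_le)
          obtain p where p: "0 \<le> p" "g \<le> evaluation p" "d = pprt (u - r *\<^sub>R p)"
            using \<open>d \<in> D\<close> by (auto simp: D_def Q_def)
          fix y :: "'a \<Rightarrow>\<^sub>L real" assume y: "y \<in> topspace K_top"
          have py: "0 \<le> blinfun_apply y p" by (rule K_top_nonneg[OF y p(1)])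
          have "blinfun_apply y u - r * blinfun_apply y p \<le> b"
          \<comment> \<open>Where u is at most b, subtracting a nonnegative value suffices.
            Elsewhere the peak property puts \<open>norm x *\<^sub>R y\<close> into
            \<open>V\<close>, so p exceeds g x / 2 there and, by homogeneity and
            \<open>norm x \<le> 1\<close>, also at y; the difference is then at most 0.\<close>
          proof (cases "b < blinfun_apply y u")
            case False
            moreover have "0 \<le> r * blinfun_apply y p" using r py by simp
            ultimately show ?thesis by linarith
          next
            case True
            let ?z = "norm x *\<^sub>R y"
            have x1: "norm x \<le> 1" using x by (simp add: topspace_K_top)
            have z: "?z \<in> topspace K_top" by (rule K_top_scaleR[OF y norm_ge_zero x1])
            have "?z \<in> V"
              using peak[OF y True] by (intro V z) (simp add: blinfun.scaleR_left)
            then have "g x / 2 < blinfun_apply ?z p"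
              using le_funD[OF p(2), of ?z] z by (simp add: V_def evaluation_def)
            also have "\<dots> \<le> blinfun_apply y p"
              using x1 py by (simp add: blinfun.scaleR_left mult_left_le_one_le)
            finally have "1 \<le> r * blinfun_apply y p"
              using gx by (simp add: r_def field_simps)
            moreover have "blinfun_apply y u \<le> 1"
              using K_top_abs_le_norm[OF y, of u] u(2) by linarith
            ultimately show ?thesis using b by linarith
          qed
          then show "blinfun_apply y d \<le> b"
            using b by (simp add: p K_top_pprt[OF y] blinfun.diff_right blinfun.scaleR_right)
        qed (use b that in \<open>auto simp: D_def\<close>)
      qed
      with b show False by simp
    qed
  qed
qed

theorem theorem7p5:
  "semicontinuous TYPE('a::am_space) \<longleftrightarrow>
     regular_sublattice (range (evaluation :: 'a \<Rightarrow> ('a \<Rightarrow>\<^sub>L real) \<Rightarrow> real)) (C_of K_top)"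
  using regular_if_semicontinuous semicontinuous_if_regular by blast

end
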